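(* Let $0<\alpha<1$, $a\ge 0$, $b>0$ and $x(t)=(t-a)^b$ for $t\ge a$. Suppose that the kernel $\Psi_{1-\alpha}(\cdot;\Theta)$ belongs to $L^1_{\mathrm{loc}}(0,\infty)$. Then the Caputo dynamic-memory fractional derivative (with lower limit $a$) satisfies, for $t>a$, $${}^c\mathcal D_{\Phi,a+}^\alpha (t-a)^b=b\int_a^t\Psi_{1-\alpha}(t-s;\Theta)(s-a)^{b-1}\,ds.$$ Equivalently, $${}^c\mathcal D_{\Phi,a+}^\alpha (t-a)^b=b\,\big(\Psi_{1-\alpha}*(\cdot-a)^{b-1}\big)(t),$$ where the convolution is taken over $[a,t]$.
   Context: A dynamic memory generator is a positive function $\Phi(p,\Theta)$ of the Laplace variable $p\in(0,\infty)$ and of fixed modulation parameters $\Theta$. For $\gamma>0$ the dynamic-memory kernel is $\Psi_\gamma(t;\Theta)=\mathcal L^{-1}\{\Phi(p,\Theta)^{-\gamma}\}(t)$, the function on $(0,\infty)$ whose Laplace transform is $\Phi(p,\Theta)^{-\gamma}$. $L^1_{\mathrm{loc}}(0,\infty)$ is the set of functions on $(0,\infty)$ that are integrable on $(0,c)$ for every $c>0$. For $0<\alpha<1$ the (left-sided) Caputo dynamic-memory fractional derivative with lower limit $a$ is $({}^c\mathcal D_{\Phi,a+}^\alpha x)(t)=\int_a^t\Psi_{1-\alpha}(t-s;\Theta)x'(s)\,ds$. Convolution over $[a,t]$ means $(f*g)(t)=\int_a^t f(t-s)g(s)\,ds$. *)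

theory Defs
  imports "HOL-Analysis.Analysis"
begin

definition dm_generator :: "(real \<Rightarrow> 'p \<Rightarrow> real) \<Rightarrow> 'p \<Rightarrow> bool" where
  "dm_generator \<Phi> \<Theta> \<longleftrightarrow> (\<forall>p>0. 0 < \<Phi> p \<Theta>)"

(* The gauge integral over the half-line covers both absolutely convergent Laplace
   integrals and improper, conditionally convergent ones. *)
definition has_laplace_transform :: "(real \<Rightarrow> real) \<Rightarrow> (real \<Rightarrow> real) \<Rightarrow> bool" where
  "has_laplace_transform f F \<longleftrightarrow>
     (\<forall>p>0. ((\<lambda>t. exp (- p * t) * f t) has_integral F p) {0<..})"

(* A relation rather than an operator, because the inverse Laplace transform is determined
   only up to a null set. Values of \<psi> outside (0,\<infinity>) are irrelevant. *)
definition dm_kernel :: "(real \<Rightarrow> 'p \<Rightarrow> real) \<Rightarrow> 'p \<Rightarrow> real \<Rightarrow> (real \<Rightarrow> real) \<Rightarrow> bool" where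
  "dm_kernel \<Phi> \<Theta> \<gamma> \<psi> \<longleftrightarrow> has_laplace_transform \<psi> (\<lambda>p. \<Phi> p \<Theta> powr (- \<gamma>))"

definition L1_loc :: "(real \<Rightarrow> real) \<Rightarrow> bool" where
  "L1_loc f \<longleftrightarrow> (\<forall>c>0. f absolutely_integrable_on {0<..<c})"

(* \<Psi> \<gamma> t \<Theta> stands for the kernel of order \<gamma> at time t. The Lebesgue integral is 0
   by convention when the integrand is not integrable; the integrands at s = a and s = t,
   where the derivative of x or the kernel may be meaningless, do not contribute. *)
definition caputo_dm ::
    "(real \<Rightarrow> real \<Rightarrow> 'p \<Rightarrow> real) \<Rightarrow> 'p \<Rightarrow> real \<Rightarrow> real \<Rightarrow> (real \<Rightarrow> real) \<Rightarrow> real \<Rightarrow> real" where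
  "caputo_dm \<Psi> \<Theta> \<alpha> a x t =
     (LINT s:{a..t}|lebesgue. \<Psi> (1 - \<alpha>) (t - s) \<Theta> * deriv x s)"

definition caputo_dm_exists ::
    "(real \<Rightarrow> real \<Rightarrow> 'p \<Rightarrow> real) \<Rightarrow> 'p \<Rightarrow> real \<Rightarrow> real \<Rightarrow> (real \<Rightarrow> real) \<Rightarrow> real \<Rightarrow> bool" where
  "caputo_dm_exists \<Psi> \<Theta> \<alpha> a x t \<longleftrightarrow>
     (\<lambda>s. \<Psi> (1 - \<alpha>) (t - s) \<Theta> * deriv x s) absolutely_integrable_on {a..t}"

definition convolution_from :: "real \<Rightarrow> (real \<Rightarrow> real) \<Rightarrow> (real \<Rightarrow> real) \<Rightarrow> real \<Rightarrow> real" where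
  "convolution_from a f g t = (LINT s:{a..t}|lebesgue. f (t - s) * g s)"

end

theory Submission
  imports Defs
begin

text \<open>
  For \<open>s > a\<close> the derivative of \<open>x\<close> is \<open>b * (s - a) powr (b - 1)\<close>, and the single
  point \<open>s = a\<close>, where \<open>x\<close> need not be differentiable, is a null set.
  Hence the Caputo integrand agrees almost everywhere with \<open>b\<close> times the convolution integrand,
  which settles the formulas and the equivalence of their integrability for each \<open>t\<close> separately.

  Integrability itself need not hold for every \<open>t\<close>: when \<open>b < 1\<close> both the kernel and the
  power may be unbounded, and a product of two integrable functions need not be integrable.
  It does hold for almost every \<open>t\<close>, by Tonelli's theorem
  (\<open>AE_integrable_convolution\<close>): if \<open>F\<close> and \<open>G\<close> are integrable on the line, then
  \<open>\<bar>F (t - s) * G s\<bar>\<close> is integrable in \<open>(t, s)\<close>, with integral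
  \<open>(\<integral>\<bar>F\<bar>) * (\<integral>\<bar>G\<bar>)\<close>. For \<open>a < t < a + c\<close> the convolution over
  \<open>{a..t}\<close> only involves the kernel on \<open>{0<..<c}\<close> and the power on \<open>{a..a + c}\<close>, so
  both may be cut off outside these sets, where local integrability makes them integrable; letting
  \<open>c\<close> run through the positive integers covers all \<open>t > a\<close>.
\<close>

text \<open>
  Translation invariance makes \<open>\<integral>\<bar>F (t - s)\<bar> dt\<close> the same for all \<open>s\<close>, so the iterated
  integral of \<open>\<bar>F (t - s) * G s\<bar>\<close> factorises and is finite.
\<close>

lemma AE_integrable_convolution_lborel:
  fixes F G :: "real \<Rightarrow> real"
  assumes F: "integrable lborel F" and G: "integrable lborel G"
  shows "AE t in lborel. integrable lborel (\<lambda>s. F (t - s) * G s)"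
proof -
  have [measurable]: "F \<in> borel_measurable borel" "G \<in> borel_measurable borel"
    using F G by auto
  have shift: "integrable lborel (\<lambda>t. F (t - s))" for s
    using lborel_integrable_real_affine[OF F, of 1 "- s"] by simp
  have mass: "(\<integral>t. \<bar>F (t - s)\<bar> \<partial>lborel) = (\<integral>t. \<bar>F t\<bar> \<partial>lborel)" for s
    using lborel_integral_real_affine[of 1 "\<lambda>t. \<bar>F t\<bar>" "- s"] by simp
  \<comment> \<open>The first coordinate is \<open>s\<close>: integrating over \<open>t\<close> first is what splits off the mass of \<open>F\<close>.\<close>
  have "integrable (lborel \<Otimes>\<^sub>M lborel) (\<lambda>(s, t). F (t - s) * G s)"
  proof (rule lborel_pair.Fubini_integrable)
    show "(\<lambda>(s, t). F (t - s) * G s) \<in> borel_measurable (lborel \<Otimes>\<^sub>M lborel)"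
      by measurable
    show "integrable lborel (\<lambda>s. \<integral>t. norm (case (s, t) of (s, t) \<Rightarrow> F (t - s) * G s) \<partial>lborel)"
      using G by (simp add: abs_mult mass)
    show "AE s in lborel. integrable lborel (\<lambda>t. case (s, t) of (s, t) \<Rightarrow> F (t - s) * G s)"
      using shift by simp
  qed
  from lborel_pair.AE_integrable_snd[OF this] show ?thesis
    by simp
qed

text \<open>
  Measurability of \<open>g\<close> is part of the conclusion: it comes from completeness of the Lebesgue
  measure and would fail for a Borel measure.
\<close>

lemma integrable_lebesgue_AE_transfer:
  fixes f g :: "'a::euclidean_space \<Rightarrow> 'b::euclidean_space"
  assumes "AE s in lebesgue. f s = g s" and f: "integrable lebesgue f"
  shows "integrable lebesgue g"
proof -
  obtain N where "negligible N" and "{s. f s \<noteq> g s} \<subseteq> N"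
    using assms(1) by (auto simp: eventually_ae_filter_negligible)
  then have N: "g s = f s" if "s \<in> UNIV - N" for s
    using that by force
  have "f absolutely_integrable_on UNIV"
    using f by (simp add: set_integrable_def)
  then have "g absolutely_integrable_on UNIV"
    using \<open>negligible N\<close> by (rule absolutely_integrable_spike) (rule N)
  then show ?thesis by (simp add: set_integrable_def)
qed

text \<open>
  Lebesgue measurability of \<open>F\<close> and \<open>G\<close> does not make \<open>(t, s) \<mapsto> F (t - s) * G s\<close> measurable
  for the product of the Borel \<open>\<sigma>\<close>-algebras, so \<open>F\<close> and \<open>G\<close> are first replaced by Borel
  representatives. This changes no integral in \<open>s\<close>, because the affine map \<open>s \<mapsto> t - s\<close> pulls null
  sets back to null sets.
\<close>

lemma AE_integrable_convolution:
  fixes F G :: "real \<Rightarrow> real"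
  assumes F: "integrable lebesgue F" and G: "integrable lebesgue G"
  shows "AE t in lebesgue. integrable lebesgue (\<lambda>s. F (t - s) * G s)"
proof -
  obtain F' where F'[measurable]: "F' \<in> borel_measurable lborel" and FF': "AE s in lborel. F s = F' s"
    using completion_ex_borel_measurable_real[of F lborel] F by auto
  obtain G' where G'[measurable]: "G' \<in> borel_measurable lborel" and GG': "AE s in lborel. G s = G' s"
    using completion_ex_borel_measurable_real[of G lborel] G by auto
  have intF': "integrable lborel F'"
    using integrable_lebesgue_AE_transfer[OF AE_completion[OF FF'] F]
    by (simp add: integrable_completion)
  have intG': "integrable lborel G'"
    using integrable_lebesgue_AE_transfer[OF AE_completion[OF GG'] G]
    by (simp add: integrable_completion)
  obtain N where N: "N \<in> null_sets lborel" and sub: "{s. F s \<noteq> F' s} \<subseteq> N"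
    using FF' by (auto simp: eventually_ae_filter)
  have [measurable]: "N \<in> sets borel" using N by auto
  have "AE u in lborel. u \<notin> N" using N by (rule AE_not_in)
  then have refl: "AE s in lborel. t - s \<notin> N" for t
    using AE_borel_affine[of "-1" "\<lambda>u. u \<notin> N" t] by simp
  have repl: "AE s in lebesgue. F' (t - s) * G' s = F (t - s) * G s" for t
  proof (rule AE_completion)
    show "AE s in lborel. F' (t - s) * G' s = F (t - s) * G s"
      using refl[of t] GG'
    proof eventually_elim
      case (elim s)
      then have "F (t - s) = F' (t - s)" using sub by blast
      with elim show ?case by simp
    qed
  qed
  have "integrable lebesgue (\<lambda>s. F (t - s) * G s)"
    if "integrable lborel (\<lambda>s. F' (t - s) * G' s)" for t
  proof -
    have "integrable lebesgue (\<lambda>s. F' (t - s) * G' s)"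
      using that by (simp add: integrable_completion)
    with repl[of t] show ?thesis
      by (rule integrable_lebesgue_AE_transfer)
  qed
  then show ?thesis
    using AE_completion[OF AE_integrable_convolution_lborel[OF intF' intG']]
    by (auto elim: AE_mp)
qed

lemma integrable_shifted_powr:
  fixes a r c :: real
  assumes "r > -1" "c \<ge> 0"
  shows "integrable lebesgue (\<lambda>s. indicator {a..a + c} s * (s - a) powr r)"
proof -
  have "(\<lambda>u. u powr r) integrable_on {0..c}"
    using has_integral_powr_from_0[OF assms] by blast
  then have "(\<lambda>u. u powr r) absolutely_integrable_on {0..c}"
    by (rule nonnegative_absolutely_integrable_1) simp
  then have "integrable lborel (\<lambda>u. indicator {0..c} u * u powr r)"
    by (simp add: set_integrable_def integrable_completion)
  from lborel_integrable_real_affine[OF this, of 1 "- a"]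
  have "integrable lborel (\<lambda>s. indicator {0..c} (s - a) * (s - a) powr r)"
    by simp
  also have "(\<lambda>s. indicator {0..c} (s - a) * (s - a) powr r)
      = (\<lambda>s. indicator {a..a + c} s * (s - a) powr r)"
    by (auto simp: fun_eq_iff indicator_def)
  finally show ?thesis
    by (simp add: integrable_completion)
qed

lemma AE_absolutely_integrable_convolution_powr:
  fixes f :: "real \<Rightarrow> real" and a r :: real
  assumes f: "L1_loc f" and r: "r > -1"
  shows "AE t in lebesgue. a < t \<longrightarrow>
    (\<lambda>s. f (t - s) * (s - a) powr r) absolutely_integrable_on {a..t}"
proof -
  have "AE t in lebesgue. a < t \<and> t < a + real n \<longrightarrow>
    (\<lambda>s. f (t - s) * (s - a) powr r) absolutely_integrable_on {a..t}" for n
  proof (cases "n = 0")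
    case False
    define c where "c = real n"
    define F where "F = (\<lambda>u. indicator {0<..<c} u * f u)"
    define G where "G = (\<lambda>s. indicator {a..a + c} s * (s - a) powr r)"
    have "c > 0" using False by (simp add: c_def)
    then have "integrable lebesgue F"
      using f by (simp add: F_def L1_loc_def set_integrable_def)
    moreover have "integrable lebesgue G"
      unfolding G_def using r \<open>c > 0\<close> by (intro integrable_shifted_powr) auto
    ultimately have "AE t in lebesgue. integrable lebesgue (\<lambda>s. F (t - s) * G s)"
      by (rule AE_integrable_convolution)
    then show ?thesis
    proof eventually_elim
      case (elim t)
      show ?case
      proof
        assume t: "a < t \<and> t < a + real n"
        \<comment> \<open>For \<open>t < a + c\<close> the two cut-offs overlap exactly in the open interval, up to the
            endpoint \<open>a\<close>, where the power is \<open>0\<close> by convention (\<open>0 powr r = 0\<close>).\<close>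
        have eq: "F (t - s) * G s = indicator {a<..<t} s *\<^sub>R (f (t - s) * (s - a) powr r)" for s
          using t by (auto simp: F_def G_def c_def indicator_def)
        have "(\<lambda>s. f (t - s) * (s - a) powr r) absolutely_integrable_on {a<..<t}"
          unfolding set_integrable_def using elim by (simp only: eq)
        then show "(\<lambda>s. f (t - s) * (s - a) powr r) absolutely_integrable_on {a..t}"
          by (rule absolutely_integrable_spike_set) (auto intro: negligible_subset[of "{a, t}"])
      qed
    qed
  qed auto
  then have "AE t in lebesgue. \<forall>n::nat. a < t \<and> t < a + real n \<longrightarrow>
    (\<lambda>s. f (t - s) * (s - a) powr r) absolutely_integrable_on {a..t}"
    unfolding AE_all_countable by blast
  then show ?thesis
  proof eventually_elim
    case (elim t)
    obtain n :: nat where "t - a < real n"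
      using reals_Archimedean2 by blast
    with elim show ?case by (auto simp: algebra_simps)
  qed
qed

lemma deriv_eq_powr:
  fixes x :: "real \<Rightarrow> real"
  assumes x: "\<And>t. a \<le> t \<Longrightarrow> x t = (t - a) powr b" and s: "a < s"
  shows "deriv x s = b * (s - a) powr (b - 1)"
proof -
  have "((\<lambda>t. (t - a) powr b) has_real_derivative b * (s - a) powr (b - 1)) (at s)"
    using s by (auto intro!: derivative_eq_intros)
  then have "(x has_real_derivative b * (s - a) powr (b - 1)) (at s)"
    by (rule has_field_derivative_transform_within_open[where S = "{a<..}"]) (use s x in auto)
  then show ?thesis by (rule DERIV_imp_deriv)
qed

theorem theorem3p37:
  fixes \<Phi> :: "real \<Rightarrow> 'p \<Rightarrow> real" and \<Theta> :: 'p
    and \<Psi> :: "real \<Rightarrow> real \<Rightarrow> 'p \<Rightarrow> real"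
    and \<alpha> a b :: real and x :: "real \<Rightarrow> real"
  assumes "0 < \<alpha>" and "\<alpha> < 1" and "0 \<le> a" and "0 < b"
    and "dm_generator \<Phi> \<Theta>"
    and "dm_kernel \<Phi> \<Theta> (1 - \<alpha>) (\<lambda>t. \<Psi> (1 - \<alpha>) t \<Theta>)"
    and "L1_loc (\<lambda>t. \<Psi> (1 - \<alpha>) t \<Theta>)"
    and "\<And>t. a \<le> t \<Longrightarrow> x t = (t - a) powr b"
  shows "(\<forall>t>a.
      (caputo_dm_exists \<Psi> \<Theta> \<alpha> a x t \<longleftrightarrow>
         (\<lambda>s. \<Psi> (1 - \<alpha>) (t - s) \<Theta> * (s - a) powr (b - 1)) absolutely_integrable_on {a..t}) \<and>
      caputo_dm \<Psi> \<Theta> \<alpha> a x t =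
        b * (LINT s:{a..t}|lebesgue. \<Psi> (1 - \<alpha>) (t - s) \<Theta> * (s - a) powr (b - 1)) \<and>
      caputo_dm \<Psi> \<Theta> \<alpha> a x t =
        b * convolution_from a (\<lambda>u. \<Psi> (1 - \<alpha>) u \<Theta>) (\<lambda>s. (s - a) powr (b - 1)) t) \<and>
    (AE t in lebesgue. a < t \<longrightarrow> caputo_dm_exists \<Psi> \<Theta> \<alpha> a x t)"
proof -
  define f where "f = (\<lambda>u. \<Psi> (1 - \<alpha>) u \<Theta>)"
  let ?C = "\<lambda>t s. f (t - s) * (s - a) powr (b - 1)"
  have deriv: "f (t - s) * deriv x s = b * ?C t s" if "a < s" for t s
    using deriv_eq_powr[of a x b, OF assms(8) that] by simp
  have exists_iff: "caputo_dm_exists \<Psi> \<Theta> \<alpha> a x t \<longleftrightarrow> ?C t absolutely_integrable_on {a..t}" for t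
  proof -
    have "caputo_dm_exists \<Psi> \<Theta> \<alpha> a x t \<longleftrightarrow>
        (\<lambda>s. f (t - s) * deriv x s) absolutely_integrable_on {a..t}"
      by (simp add: caputo_dm_exists_def f_def)
    also have "\<dots> \<longleftrightarrow> (\<lambda>s. b * ?C t s) absolutely_integrable_on {a..t}"
      by (rule absolutely_integrable_spike_eq[of "{a}"]) (auto simp: deriv simp del: mult_cancel_left)
    also have "\<dots> \<longleftrightarrow> ?C t absolutely_integrable_on {a..t}"
      using \<open>0 < b\<close> by simp
    finally show ?thesis .
  qed
  have caputo_eq: "caputo_dm \<Psi> \<Theta> \<alpha> a x t = b * (LINT s:{a..t}|lebesgue. ?C t s)" for t
  proof (cases "?C t absolutely_integrable_on {a..t}")
    case True
    then have bC: "(\<lambda>s. b * ?C t s) absolutely_integrable_on {a..t}"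
      by simp
    have D: "(\<lambda>s. f (t - s) * deriv x s) absolutely_integrable_on {a..t}"
      using True exists_iff[of t] by (simp add: caputo_dm_exists_def f_def)
    have "caputo_dm \<Psi> \<Theta> \<alpha> a x t = (LINT s:{a..t}|lebesgue. f (t - s) * deriv x s)"
      by (simp add: caputo_dm_def f_def)
    also have "\<dots> = integral {a..t} (\<lambda>s. f (t - s) * deriv x s)"
      by (rule set_lebesgue_integral_eq_integral(2)[OF D])
    also have "\<dots> = integral {a..t} (\<lambda>s. b * ?C t s)"
      by (rule integral_spike[of "{a}"]) (auto simp: deriv simp del: mult_cancel_left)
    also have "\<dots> = (LINT s:{a..t}|lebesgue. b * ?C t s)"
      by (rule set_lebesgue_integral_eq_integral(2)[OF bC, symmetric])
    also have "\<dots> = b * (LINT s:{a..t}|lebesgue. ?C t s)"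
      by simp
    finally show ?thesis .
  next
    \<comment> \<open>Neither integrand is integrable, and both integrals take the default value \<open>0\<close>.\<close>
    case False
    then have "\<not> caputo_dm_exists \<Psi> \<Theta> \<alpha> a x t"
      by (simp add: exists_iff)
    with False show ?thesis
      by (simp add: caputo_dm_exists_def caputo_dm_def set_integrable_def
          set_lebesgue_integral_def not_integrable_integral_eq)
  qed
  have "AE t in lebesgue. a < t \<longrightarrow> caputo_dm_exists \<Psi> \<Theta> \<alpha> a x t"
    unfolding exists_iff
    by (rule AE_absolutely_integrable_convolution_powr) (use assms in \<open>auto simp: f_def\<close>)
  then show ?thesis
    using exists_iff caputo_eq by (simp add: convolution_from_def f_def)
qed

end
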